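(* Let $X$ be a metrizable, separable, locally compact space and let $\mathcal F=\{f_1,\dots,f_m\}$ be an iterated function system on $X$ with compact dynamics and global attractor $\mathcal G_{\mathcal F}$. Let $\widehat F$ be the full one-sided step skew product on $\Sigma_m^+\times\mathcal G_{\mathcal F}$ and $\pi_X:\Sigma_m^+\times\mathcal G_{\mathcal F}\to\mathcal G_{\mathcal F}$, $\pi_X(\omega,x)=x$. Then $\pi_X$ maps the chain-recurrent set $\mathcal R_{\mathcal C_{\widehat F}}$ of $\widehat F$ onto the chain-recurrent set $\mathcal R_{\mathcal C_{\mathcal F}}$ of $\mathcal F$ and induces (via $\widehat N\mapsto\pi_X(\widehat N)$) a bijection between the chain nodes of $\widehat F$ and the chain nodes of $\mathcal F$. More precisely, if $\widehat N,\widehat M$ are chain nodes of $\widehat F$, then $$\widehat N\succcurlyeq_{\mathcal C_{\widehat F}}\widehat M\iff\pi_X(\widehat N)\succcurlyeq_{\mathcal C_{\mathcal F}}\pi_X(\widehat M),$$ so that $\pi_X$ induces an isomorphism of directed graphs between the chain graph of $\widehat F$ and the chain graph of $\mathcal F$. Moreover, if $N$ is a chain node of $\mathcal F$, the corresponding chain node of $\widehat F$ is $$\widehat N=\mathcal R_{\mathcal C_{\widehat F}}\cap(\Sigma_m^+\times N).$$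
   Context: Fix any metric $d$ on $X$ compatible with its topology. An iterated function system (IFS) on a metric space $(Y,d)$ is a finite collection $\mathcal F=\{f_1,\dots,f_m\}$, $m\ge1$, of continuous maps $Y\to Y$. $\mathcal I^m$ is the set of all finite words in the letters $1,\dots,m$ (including the empty word $0$); $|I|$ is the length of $I$. For $I=i_1\cdots i_k$, $\Phi^I_{\mathcal F}=f_{i_k}\circ\dots\circ f_{i_1}$, and $\Phi^0_{\mathcal F}=\mathrm{id}$. $H_{\mathcal F}(A)=\bigcup_{i=1}^m f_i(A)$; $A$ is $H$-invariant if $H_{\mathcal F}(A)=A$. $N_\varepsilon(A)=\{x:d(x,A)<\varepsilon\}$. $A$ attracts $K$ if for every $\varepsilon>0$ there is $\tau>0$ with $\Phi^I_{\mathcal F}(K)\subset N_\varepsilon(A)$ for every $|I|\ge\tau$. A global attractor is a compact $H$-invariant set that attracts every compact subset of the space; it is unique if it exists and is denoted $\mathcal G_{\mathcal F}$. $\mathcal F$ has compact dynamics if it has a global attractor. Chains: an $\varepsilon$-chain from $x$ to $y$ is a finite sequence $x_0=x,x_1,\dots,x_k=y$ ($k\ge0$) with indices $i_0,\dots,i_{k-1}$ such that $d(f_{i_n}(x_n),x_{n+1})<\varepsilon$ for $n=0,\dots,k-1$. Write $x\succcurlyeq_{\mathcal C_{\mathcal F}}y$ if for every $\varepsilon>0$ there is an $\varepsilon$-chain from $x$ to $y$; $x,y$ are chain-equivalent if $x\succcurlyeq_{\mathcal C_{\mathcal F}} y$ and $y\succcurlyeq_{\mathcal C_{\mathcal F}}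 x$. A point $x$ is chain-recurrent if it is chain-equivalent to $f_i(x)$ for some $i$. Chain nodes are the chain-equivalence classes of the set $\mathcal R_{\mathcal C_{\mathcal F}}$ of chain-recurrent points. For nodes, $N\succcurlyeq_{\mathcal C_{\mathcal F}} M$ means $x\succcurlyeq_{\mathcal C_{\mathcal F}} y$ for some $x\in N,y\in M$. The chain graph has the chain nodes as vertices and an edge from $N$ to $M\ne N$ when $N\succcurlyeq_{\mathcal C_{\mathcal F}}M$. $\Sigma_m^+=\{1,\dots,m\}^{\mathbb N_0}$ with metric $d_\Sigma(\omega,\omega)=0$ and $d_\Sigma(\omega,\nu)=2^{-\min\{j\ge0:\,\omega_j\ne\nu_j\}}$ for $\omega\neq\nu$; $\sigma(\omega_0,\omega_1,\dots)=(\omega_1,\omega_2,\dots)$ is the left shift. $\Sigma_m^+\times\mathcal G_{\mathcal F}$ carries the maximum of $d_\Sigma$ and $d$. The full one-sided step skew product is the map $\widehat F(\omega,x)=(\sigma\omega,f_{\omega_0}(x))$ of $\Sigma_m^+\times\mathcal G_{\mathcal F}$ into itself; its chain notions are those of the one-generator IFS $\{\widehat F\}$. *)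

theory Defs
  imports "HOL-Analysis.Analysis" "Graph_Theory.Digraph_Isomorphism"
begin

section \<open>Iterated function systems\<close>

text \<open>
  All notions take the underlying metric space as an explicit carrier \<open>Y\<close> with a distance
  function \<open>d\<close>, because they are used both for the space \<open>X\<close> and for the subset
  \<open>\<Sigma> \<times> \<G>\<close> of a product type with the maximum metric (the library metric on product types
  is the Euclidean one). The maps \<open>f\<^sub>1, \<dots>, f\<^sub>m\<close> are the values \<open>f 1, \<dots>, f m\<close> of a function on \<open>nat\<close>.
\<close>

definition IFS :: "'a set \<Rightarrow> ('a \<Rightarrow> 'a \<Rightarrow> real) \<Rightarrow> nat \<Rightarrow> (nat \<Rightarrow> 'a \<Rightarrow> 'a) \<Rightarrow> bool" where
  "IFS Y d m f \<longleftrightarrow>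
     Metric_space Y d \<and> m \<ge> 1 \<and>
     (\<forall>i\<in>{1..m}. continuous_map (Metric_space.mtopology Y d) (Metric_space.mtopology Y d) (f i))"

text \<open>
  \<open>fold\<close> applies the first letter of the word first:
  \<open>word_map f [i\<^sub>1, \<dots>, i\<^sub>k] = f i\<^sub>k \<circ> \<dots> \<circ> f i\<^sub>1\<close>.
\<close>

definition word_map :: "(nat \<Rightarrow> 'a \<Rightarrow> 'a) \<Rightarrow> nat list \<Rightarrow> 'a \<Rightarrow> 'a" where
  "word_map f I = fold f I"

definition hutchinson :: "nat \<Rightarrow> (nat \<Rightarrow> 'a \<Rightarrow> 'a) \<Rightarrow> 'a set \<Rightarrow> 'a set" where
  "hutchinson m f A = (\<Union>i\<in>{1..m}. f i ` A)"

text \<open>\<open>d(x, A) < \<epsilon>\<close> is unfolded as in the definition of an infimum; the neighbourhood of the empty set is empty.\<close>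

definition nbhd :: "'a set \<Rightarrow> ('a \<Rightarrow> 'a \<Rightarrow> real) \<Rightarrow> real \<Rightarrow> 'a set \<Rightarrow> 'a set" where
  "nbhd Y d \<epsilon> A = {x \<in> Y. \<exists>a\<in>A. d x a < \<epsilon>}"

definition attracts ::
  "'a set \<Rightarrow> ('a \<Rightarrow> 'a \<Rightarrow> real) \<Rightarrow> nat \<Rightarrow> (nat \<Rightarrow> 'a \<Rightarrow> 'a) \<Rightarrow> 'a set \<Rightarrow> 'a set \<Rightarrow> bool" where
  "attracts Y d m f A K \<longleftrightarrow>
     (\<forall>\<epsilon>>0. \<exists>\<tau>>0. \<forall>I\<in>lists {1..m}. length I \<ge> \<tau> \<longrightarrow> word_map f I ` K \<subseteq> nbhd Y d \<epsilon> A)"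

definition global_attractor ::
  "'a set \<Rightarrow> ('a \<Rightarrow> 'a \<Rightarrow> real) \<Rightarrow> nat \<Rightarrow> (nat \<Rightarrow> 'a \<Rightarrow> 'a) \<Rightarrow> 'a set \<Rightarrow> bool" where
  "global_attractor Y d m f A \<longleftrightarrow>
     compactin (Metric_space.mtopology Y d) A \<and>
     hutchinson m f A = A \<and>
     (\<forall>K. compactin (Metric_space.mtopology Y d) K \<longrightarrow> attracts Y d m f A K)"


section \<open>Chains\<close>

text \<open>The length \<open>k\<close> may be 0, so every point of \<open>Y\<close> is chained to itself.\<close>

definition eps_chain ::
  "'a set \<Rightarrow> ('a \<Rightarrow> 'a \<Rightarrow> real) \<Rightarrow> nat \<Rightarrow> (nat \<Rightarrow> 'a \<Rightarrow> 'a) \<Rightarrow> real \<Rightarrow> 'a \<Rightarrow> 'a \<Rightarrow> bool" where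
  "eps_chain Y d m f \<epsilon> x y \<longleftrightarrow>
     (\<exists>(k::nat) (p :: nat \<Rightarrow> 'a) (i :: nat \<Rightarrow> nat).
        p 0 = x \<and> p k = y \<and> (\<forall>n\<le>k. p n \<in> Y) \<and>
        (\<forall>n<k. i n \<in> {1..m} \<and> d (f (i n) (p n)) (p (Suc n)) < \<epsilon>))"

definition chain_ge ::
  "'a set \<Rightarrow> ('a \<Rightarrow> 'a \<Rightarrow> real) \<Rightarrow> nat \<Rightarrow> (nat \<Rightarrow> 'a \<Rightarrow> 'a) \<Rightarrow> 'a \<Rightarrow> 'a \<Rightarrow> bool" where
  "chain_ge Y d m f x y \<longleftrightarrow> (\<forall>\<epsilon>>0. eps_chain Y d m f \<epsilon> x y)"

definition chain_equiv ::
  "'a set \<Rightarrow> ('a \<Rightarrow> 'a \<Rightarrow> real) \<Rightarrow> nat \<Rightarrow> (nat \<Rightarrow> 'a \<Rightarrow> 'a) \<Rightarrow> 'a \<Rightarrow> 'a \<Rightarrow> bool" where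
  "chain_equiv Y d m f x y \<longleftrightarrow> chain_ge Y d m f x y \<and> chain_ge Y d m f y x"

definition chain_recurrent_set ::
  "'a set \<Rightarrow> ('a \<Rightarrow> 'a \<Rightarrow> real) \<Rightarrow> nat \<Rightarrow> (nat \<Rightarrow> 'a \<Rightarrow> 'a) \<Rightarrow> 'a set" where
  "chain_recurrent_set Y d m f = {x \<in> Y. \<exists>i\<in>{1..m}. chain_equiv Y d m f x (f i x)}"

definition chain_nodes ::
  "'a set \<Rightarrow> ('a \<Rightarrow> 'a \<Rightarrow> real) \<Rightarrow> nat \<Rightarrow> (nat \<Rightarrow> 'a \<Rightarrow> 'a) \<Rightarrow> 'a set set" where
  "chain_nodes Y d m f =
     chain_recurrent_set Y d m f //
       {(x, y). x \<in> chain_recurrent_set Y d m f \<and> y \<in> chain_recurrent_set Y d m f \<and>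
                chain_equiv Y d m f x y}"

definition node_ge ::
  "'a set \<Rightarrow> ('a \<Rightarrow> 'a \<Rightarrow> real) \<Rightarrow> nat \<Rightarrow> (nat \<Rightarrow> 'a \<Rightarrow> 'a) \<Rightarrow> 'a set \<Rightarrow> 'a set \<Rightarrow> bool" where
  "node_ge Y d m f N M \<longleftrightarrow> (\<exists>x\<in>N. \<exists>y\<in>M. chain_ge Y d m f x y)"

definition chain_graph ::
  "'a set \<Rightarrow> ('a \<Rightarrow> 'a \<Rightarrow> real) \<Rightarrow> nat \<Rightarrow> (nat \<Rightarrow> 'a \<Rightarrow> 'a) \<Rightarrow> ('a set, 'a set \<times> 'a set) pre_digraph"
where
  "chain_graph Y d m f =
     \<lparr>verts = chain_nodes Y d m f,
      arcs = {(N, M). N \<in> chain_nodes Y d m f \<and> M \<in> chain_nodes Y d m f \<and>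
                      N \<noteq> M \<and> node_ge Y d m f N M},
      tail = fst, head = snd\<rparr>"

text \<open>
  The library's digraph isomorphisms carry separate maps on vertices and on arcs; for graphs
  whose arcs are pairs of vertices, a vertex map \<open>h\<close> determines the arc map.
\<close>

definition induced_iso :: "('v \<Rightarrow> 'w) \<Rightarrow> ('v, 'v \<times> 'v, 'w, 'w \<times> 'w) digraph_isomorphism" where
  "induced_iso h =
     \<lparr>iso_verts = h, iso_arcs = map_prod h h, iso_head = snd, iso_tail = fst\<rparr>"


section \<open>The step skew product\<close>

definition full_shift :: "nat \<Rightarrow> (nat \<Rightarrow> nat) set" where
  "full_shift m = {\<omega>. \<forall>j. \<omega> j \<in> {1..m}}"

definition dist_shift :: "(nat \<Rightarrow> nat) \<Rightarrow> (nat \<Rightarrow> nat) \<Rightarrow> real" where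
  "dist_shift \<omega> \<nu> = (if \<omega> = \<nu> then 0 else (1/2) ^ (LEAST j. \<omega> j \<noteq> \<nu> j))"

definition max_dist ::
  "('a \<Rightarrow> 'a \<Rightarrow> real) \<Rightarrow> ('b \<Rightarrow> 'b \<Rightarrow> real) \<Rightarrow> 'a \<times> 'b \<Rightarrow> 'a \<times> 'b \<Rightarrow> real" where
  "max_dist d1 d2 p q = max (d1 (fst p) (fst q)) (d2 (snd p) (snd q))"

definition skew_product ::
  "(nat \<Rightarrow> 'a \<Rightarrow> 'a) \<Rightarrow> (nat \<Rightarrow> nat) \<times> 'a \<Rightarrow> (nat \<Rightarrow> nat) \<times> 'a" where
  "skew_product f = (\<lambda>(\<omega>, x). (\<lambda>n. \<omega> (Suc n), f (\<omega> 0) x))"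

end

theory Submission
  imports Defs
begin

text \<open>
  Near \<open>G\<close> fine chains are trapped: blocks of fixed length shadow true orbits, which \<open>G\<close> attracts.
  Hence every chain-recurrent point lies in \<open>G\<close>, and a chain between points of \<open>G\<close> can be pushed
  into \<open>G\<close>, so only chains in \<open>G\<close> matter.

  A fine chain of the skew product from \<open>(\<omega>, x)\<close> must first follow the letters of \<open>\<omega>\<close> for a long
  time, whereas far-away letters can be changed at no cost. Therefore \<open>(\<omega>, x)\<close> is chain-recurrent
  iff there are arbitrarily long and precise loops at \<open>x\<close> whose initial letters are those of \<open>\<omega>\<close>;
  and from such a point \<open>(\<nu>, y)\<close> is reached, for every \<open>\<nu>\<close>, as soon as \<open>y\<close> is reached from \<open>x\<close>.
\<close>

section \<open>Concatenation of chains\<close>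

text \<open>Keeps length, points and letters visible, so that loops can be lengthened and initial
  letters prescribed. Values of \<open>p\<close> beyond \<open>k\<close>, and of \<open>i\<close>
  from \<open>k\<close> on, are arbitrary.\<close>

definition chain_path ::
  "'a set \<Rightarrow> ('a \<Rightarrow> 'a \<Rightarrow> real) \<Rightarrow> nat \<Rightarrow> (nat \<Rightarrow> 'a \<Rightarrow> 'a) \<Rightarrow> real \<Rightarrow> nat \<Rightarrow>
    (nat \<Rightarrow> 'a) \<Rightarrow> (nat \<Rightarrow> nat) \<Rightarrow> bool" where
  "chain_path Y d m f \<epsilon> k p i \<longleftrightarrow>
     (\<forall>n\<le>k. p n \<in> Y) \<and> (\<forall>n<k. i n \<in> {1..m} \<and> d (f (i n) (p n)) (p (Suc n)) < \<epsilon>)"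

lemma eps_chain_iff:
  "eps_chain Y d m f \<epsilon> x y \<longleftrightarrow> (\<exists>k p i. p 0 = x \<and> p k = y \<and> chain_path Y d m f \<epsilon> k p i)"
  by (auto simp: eps_chain_def chain_path_def)

lemma chain_path_mono:
  "chain_path Y d m f \<epsilon> k p i \<Longrightarrow> \<epsilon> \<le> \<epsilon>' \<Longrightarrow> chain_path Y d m f \<epsilon>' k p i"
  by (force simp: chain_path_def)

lemma chain_path_take: "chain_path Y d m f \<epsilon> k p i \<Longrightarrow> l \<le> k \<Longrightarrow> chain_path Y d m f \<epsilon> l p i"
  by (auto simp: chain_path_def)

lemma chain_path_drop:
  assumes "chain_path Y d m f \<epsilon> k p i" and "l \<le> k"
  shows "chain_path Y d m f \<epsilon> (k - l) (\<lambda>n. p (n + l)) (\<lambda>n. i (n + l))"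
  using assms by (auto simp: chain_path_def)

lemma chain_path_append:
  assumes "chain_path Y d m f \<epsilon> k p i" and "chain_path Y d m f \<epsilon> l q j" and "p k = q 0"
  shows "chain_path Y d m f \<epsilon> (k + l)
           (\<lambda>n. if n < k then p n else q (n - k)) (\<lambda>n. if n < k then i n else j (n - k))"
  unfolding chain_path_def
proof (intro conjI allI impI)
  fix n assume "n \<le> k + l"
  then show "(if n < k then p n else q (n - k)) \<in> Y"
    using assms by (auto simp: chain_path_def)
next
  fix n assume n: "n < k + l"
  then show "(if n < k then i n else j (n - k)) \<in> {1..m}"
    using assms(1,2) unfolding chain_path_def by (metis less_diff_conv2 not_less add.commute)
  consider "Suc n < k" | "Suc n = k" | "k \<le> n" by linarith
  then show "d (f (if n < k then i n else j (n - k)) (if n < k then p n else q (n - k)))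
          (if Suc n < k then p (Suc n) else q (Suc n - k)) < \<epsilon>"
  proof cases
    case 1
    then show ?thesis using assms(1) by (auto simp: chain_path_def)
  next
    \<comment> \<open>This is the only step across the junction: its target \<open>p k\<close> is
      read as \<open>q 0\<close>.\<close>
    case 2
    then have "d (f (i n) (p n)) (p k) < \<epsilon>"
      using assms(1) by (auto simp: chain_path_def)
    then show ?thesis using 2 assms(3) by auto
  next
    case 3
    then have "n - k < l" "Suc n - k = Suc (n - k)" using n by auto
    then show ?thesis using assms(2) 3 by (auto simp: chain_path_def)
  qed
qed

lemma chain_path_single:
  assumes "x \<in> Y" "y \<in> Y" "i \<in> {1..m}" "d (f i x) y < \<epsilon>"
  shows "chain_path Y d m f \<epsilon> 1 (\<lambda>n. if n = 0 then x else y) (\<lambda>n. i)"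
  using assms by (auto simp: chain_path_def)

lemma chain_ge_in: "chain_ge Y d m f x y \<Longrightarrow> x \<in> Y \<and> y \<in> Y"
  unfolding chain_ge_def eps_chain_iff chain_path_def
  using zero_less_one[where ?'a = real] by blast

lemma chain_ge_refl: "x \<in> Y \<Longrightarrow> chain_ge Y d m f x x"
  unfolding chain_ge_def eps_chain_iff chain_path_def
  by (intro allI impI exI[of _ "0::nat"] exI[of _ "\<lambda>_. x"]) simp

lemma chain_ge_trans:
  assumes "chain_ge Y d m f x y" and "chain_ge Y d m f y z"
  shows "chain_ge Y d m f x z"
  unfolding chain_ge_def
proof (intro allI impI)
  fix \<epsilon> :: real assume "\<epsilon> > 0"
  then obtain k p i l q j
    where p: "p 0 = x" "p k = y" "chain_path Y d m f \<epsilon> k p i"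
      and q: "q 0 = y" "q l = z" "chain_path Y d m f \<epsilon> l q j"
    using assms unfolding chain_ge_def eps_chain_iff by meson
  define r where "r = (\<lambda>n. if n < k then p n else q (n - k))"
  have "chain_path Y d m f \<epsilon> (k + l) r (\<lambda>n. if n < k then i n else j (n - k))"
    unfolding r_def using p q by (intro chain_path_append) auto
  moreover have "r 0 = x" "r (k + l) = z"
    using p q by (auto simp: r_def)
  ultimately show "eps_chain Y d m f \<epsilon> x z"
    unfolding eps_chain_iff by blast
qed

text \<open>A chain with one exact step. Asking only for \<open>d (f i x) (f i x) = 0\<close> makes
  it applicable to \<open>max_dist\<close> without showing that this is a metric.\<close>

lemma chain_ge_image:
  assumes "x \<in> Y" "f i x \<in> Y" "i \<in> {1..m}" "d (f i x) (f i x) = 0"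
  shows "chain_ge Y d m f x (f i x)"
  unfolding chain_ge_def eps_chain_iff
proof (intro allI impI exI conjI)
  fix \<epsilon> :: real assume "\<epsilon> > 0"
  then show "chain_path Y d m f \<epsilon> 1 (\<lambda>n. if n = 0 then x else f i x) (\<lambda>n. i)"
    using assms by (intro chain_path_single) auto
qed auto

text \<open>Chains of length 0 make every point trivially chained to itself. A genuine loop arises
  by putting the exact step from \<open>x\<close> to \<open>f j x\<close> before a chain from
  \<open>f j x\<close> back to \<open>x\<close>.\<close>

lemma chain_recurrent_loop:
  assumes x: "x \<in> chain_recurrent_set Y d m f" and zero: "\<And>z. z \<in> Y \<Longrightarrow> d z z = 0"
    and \<epsilon>: "\<epsilon> > 0"
  obtains k p i where "k \<ge> 1" "p 0 = x" "p k = x" "chain_path Y d m f \<epsilon> k p i"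
proof -
  obtain j where j: "j \<in> {1..m}" and ge: "chain_ge Y d m f (f j x) x"
    using x by (auto simp: chain_recurrent_set_def chain_equiv_def)
  have Y: "f j x \<in> Y" "x \<in> Y"
    using chain_ge_in[OF ge] by auto
  obtain l q i where q: "q 0 = f j x" "q l = x" "chain_path Y d m f \<epsilon> l q i"
    using ge \<epsilon> unfolding chain_ge_def eps_chain_iff by blast
  have "chain_path Y d m f \<epsilon> 1 (\<lambda>n. if n = 0 then x else f j x) (\<lambda>n. j)"
    using Y j zero \<epsilon> by (intro chain_path_single) auto
  from chain_path_append[OF this q(3)] show ?thesis
    using q(1,2) by (intro that[of "1 + l"]) auto
qed

text \<open>Running through the loop again lengthens it at no cost in precision. The given loop
  comes first, so its \<open>k\<close> letters survive.\<close>

lemma chain_path_repeat: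
  assumes "chain_path Y d m f \<epsilon> k p i" "p 0 = x" "p k = x" "k \<ge> 1"
  obtains l q j where "l \<ge> L" "q 0 = x" "q l = x" "chain_path Y d m f \<epsilon> l q j"
    "\<And>n. n < k \<Longrightarrow> j n = i n"
proof -
  have "\<exists>l q j. l \<ge> L \<and> q 0 = x \<and> q l = x \<and> chain_path Y d m f \<epsilon> l q j \<and> (\<forall>n<k. j n = i n)"
  proof (induction L)
    case 0
    then show ?case using assms by (intro exI[of _ k] exI[of _ p] exI[of _ i]) simp
  next
    case (Suc L)
    then obtain l q j where q: "l \<ge> L" "q 0 = x" "q l = x" "chain_path Y d m f \<epsilon> l q j"
      by blast
    define r s where "r = (\<lambda>n. if n < k then p n else q (n - k))"
      and "s = (\<lambda>n. if n < k then i n else j (n - k))"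
    have "chain_path Y d m f \<epsilon> (k + l) r s"
      unfolding r_def s_def using assms q by (intro chain_path_append) auto
    moreover have "r 0 = x" "r (k + l) = x" "\<forall>n<k. s n = i n" "Suc L \<le> k + l"
      using assms q by (auto simp: r_def s_def)
    ultimately show ?case by blast
  qed
  then show ?thesis using that by blast
qed


section \<open>Transfer of the chain graph along a map\<close>

definition node_rel ::
  "'a set \<Rightarrow> ('a \<Rightarrow> 'a \<Rightarrow> real) \<Rightarrow> nat \<Rightarrow> (nat \<Rightarrow> 'a \<Rightarrow> 'a) \<Rightarrow> ('a \<times> 'a) set" where
  "node_rel Y d m f =
     {(x, y). x \<in> chain_recurrent_set Y d m f \<and> y \<in> chain_recurrent_set Y d m f \<and>
              chain_equiv Y d m f x y}"

lemma equiv_node_rel: "equiv (chain_recurrent_set Y d m f) (node_rel Y d m f)"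
proof (rule equivI)
  show "refl_on (chain_recurrent_set Y d m f) (node_rel Y d m f)"
    by (auto simp: refl_on_def node_rel_def chain_equiv_def chain_recurrent_set_def
        intro: chain_ge_refl)
  show "sym (node_rel Y d m f)"
    by (auto simp: sym_def node_rel_def chain_equiv_def)
  show "trans (node_rel Y d m f)"
    by (auto simp: trans_def node_rel_def chain_equiv_def intro: chain_ge_trans)
qed (auto simp: node_rel_def)

lemma chain_nodes_eq: "chain_nodes Y d m f = chain_recurrent_set Y d m f // node_rel Y d m f"
  by (simp add: chain_nodes_def node_rel_def)

lemma wf_digraph_chain_graph: "wf_digraph (chain_graph Y d m f)"
  by unfold_locales (auto simp: chain_graph_def)

text \<open>Purely order-theoretic: on recurrent points \<open>h\<close> preserves and reflects the
  chain relation. Hence a class in \<open>R'\<close> is the full preimage in \<open>R'\<close> of a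
  class in \<open>R\<close>, and surjectivity of \<open>h\<close> onto \<open>R\<close> makes image
  and preimage mutually inverse on nodes.\<close>

lemma chain_graph_transfer:
  fixes h :: "'b \<Rightarrow> 'a"
    and Y :: "'a set" and d :: "'a \<Rightarrow> 'a \<Rightarrow> real" and m :: nat and f :: "nat \<Rightarrow> 'a \<Rightarrow> 'a"
    and Y' :: "'b set" and d' :: "'b \<Rightarrow> 'b \<Rightarrow> real" and m' :: nat and f' :: "nat \<Rightarrow> 'b \<Rightarrow> 'b"
  defines "R \<equiv> chain_recurrent_set Y d m f" and "R' \<equiv> chain_recurrent_set Y' d' m' f'"
    and "nodes \<equiv> chain_nodes Y d m f" and "nodes' \<equiv> chain_nodes Y' d' m' f'"
  assumes image: "h ` R' = R"
    and ge_iff: "\<And>p q. p \<in> R' \<Longrightarrow> q \<in> R' \<Longrightarrow>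
      chain_ge Y' d' m' f' p q \<longleftrightarrow> chain_ge Y d m f (h p) (h q)"
  shows "bij_betw ((`) h) nodes' nodes"
    and "\<And>N M. N \<in> nodes' \<Longrightarrow> M \<in> nodes' \<Longrightarrow>
      node_ge Y' d' m' f' N M \<longleftrightarrow> node_ge Y d m f (h ` N) (h ` M)"
    and "pre_digraph.digraph_isomorphism (chain_graph Y' d' m' f') (induced_iso ((`) h))"
    and "app_iso (induced_iso ((`) h)) (chain_graph Y' d' m' f') = chain_graph Y d m f"
    and "\<And>N. N \<in> nodes \<Longrightarrow> R' \<inter> h -` N \<in> nodes' \<and> h ` (R' \<inter> h -` N) = N"
proof -
  let ?E = "node_rel Y d m f" and ?E' = "node_rel Y' d' m' f'"
  have eqv: "equiv R ?E" and eqv': "equiv R' ?E'"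
    unfolding R_def R'_def by (rule equiv_node_rel)+
  have nodes: "nodes = R // ?E" and nodes': "nodes' = R' // ?E'"
    by (simp_all add: nodes_def nodes'_def R_def R'_def chain_nodes_eq)
  have h_in: "h p \<in> R" if "p \<in> R'" for p
    using image that by blast
  have E_iff: "(p, q) \<in> ?E' \<longleftrightarrow> (h p, h q) \<in> ?E" if "p \<in> R'" "q \<in> R'" for p q
    using that h_in[OF that(1)] h_in[OF that(2)] ge_iff
    by (auto simp: node_rel_def R_def R'_def chain_equiv_def)
  have class_eq: "?E' `` {p} = R' \<inter> h -` (?E `` {h p})" if p: "p \<in> R'" for p
  proof -
    have "?E' \<subseteq> R' \<times> R'" by (auto simp: node_rel_def R'_def)
    then show ?thesis using E_iff[OF p] by auto
  qed
  have image_class: "h ` (R' \<inter> h -` (?E `` {x})) = ?E `` {x}" for x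
  proof -
    have "?E `` {x} \<subseteq> h ` R'" unfolding image by (auto simp: node_rel_def R_def)
    then show ?thesis by blast
  qed
  have nodes_sub: "N \<subseteq> R'" if "N \<in> nodes'" for N
    using that eqv' unfolding nodes' by (metis Union_quotient Union_upper)
  have image_node: "h ` N \<in> nodes \<and> N = R' \<inter> h -` (h ` N)" if N: "N \<in> nodes'" for N
  proof -
    obtain p where p: "p \<in> R'" "N = ?E' `` {p}"
      using N unfolding nodes' quotient_def by blast
    then have "N = R' \<inter> h -` (?E `` {h p})" "h ` N = ?E `` {h p}"
      using class_eq image_class by auto
    then show ?thesis
      using h_in[OF p(1)] by (simp add: nodes quotientI)
  qed
  have preimage_node: "R' \<inter> h -` N \<in> nodes' \<and> h ` (R' \<inter> h -` N) = N" if N: "N \<in> nodes" for N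
  proof -
    obtain x where x: "x \<in> R" "N = ?E `` {x}"
      using N unfolding nodes quotient_def by blast
    then obtain p where "p \<in> R'" "h p = x"
      using image by blast
    then show ?thesis
      using class_eq[of p] image_class x by (metis nodes' quotientI)
  qed
  then show "\<And>N. N \<in> nodes \<Longrightarrow> R' \<inter> h -` N \<in> nodes' \<and> h ` (R' \<inter> h -` N) = N" .
  show bij: "bij_betw ((`) h) nodes' nodes"
    using image_node preimage_node
    by (intro bij_betwI[where g = "\<lambda>N. R' \<inter> h -` N"]) auto
  show node_ge_iff: "node_ge Y' d' m' f' N M \<longleftrightarrow> node_ge Y d m f (h ` N) (h ` M)"
    if "N \<in> nodes'" "M \<in> nodes'" for N M
  proof -
    have "chain_ge Y' d' m' f' p q \<longleftrightarrow> chain_ge Y d m f (h p) (h q)" if "p \<in> N" "q \<in> M" for p q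
      using ge_iff nodes_sub \<open>N \<in> nodes'\<close> \<open>M \<in> nodes'\<close> that by blast
    then show ?thesis by (simp add: node_ge_def)
  qed
  have inj: "inj_on ((`) h) nodes'" and surj: "(`) h ` nodes' = nodes"
    using bij by (auto simp: bij_betw_def)
  have "inj_on (map_prod ((`) h) ((`) h)) (arcs (chain_graph Y' d' m' f'))"
    by (rule inj_on_subset[OF map_prod_inj_on[OF inj inj]])
      (auto simp: chain_graph_def nodes'_def)
  then show "pre_digraph.digraph_isomorphism (chain_graph Y' d' m' f') (induced_iso ((`) h))"
    unfolding pre_digraph.digraph_isomorphism_def
    using inj wf_digraph_chain_graph[of Y' d' m' f']
    by (auto simp: induced_iso_def chain_graph_def nodes'_def)
  have "map_prod ((`) h) ((`) h) ` arcs (chain_graph Y' d' m' f') = arcs (chain_graph Y d m f)"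
    (is "?A = ?B")
  proof (intro equalityI subsetI)
    fix a assume "a \<in> ?A"
    then obtain N M where "a = (h ` N, h ` M)" "N \<in> nodes'" "M \<in> nodes'" "N \<noteq> M"
      "node_ge Y' d' m' f' N M"
      by (auto simp: chain_graph_def nodes'_def)
    then show "a \<in> ?B"
      using node_ge_iff[of N M] image_node[of N] image_node[of M]
      by (auto simp: chain_graph_def nodes_def)
  next
    fix a assume "a \<in> ?B"
    then obtain N M where a: "a = (N, M)" "N \<in> nodes" "M \<in> nodes" "N \<noteq> M" "node_ge Y d m f N M"
      by (auto simp: chain_graph_def nodes_def)
    then obtain N' M' where "N' \<in> nodes'" "N = h ` N'" "M' \<in> nodes'" "M = h ` M'"
      using surj by blast
    then have "(N', M') \<in> arcs (chain_graph Y' d' m' f')"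
      using a node_ge_iff[of N' M'] by (auto simp: chain_graph_def nodes'_def)
    then show "a \<in> ?A"
      using a \<open>N = h ` N'\<close> \<open>M = h ` M'\<close> by force
  qed
  then show "app_iso (induced_iso ((`) h)) (chain_graph Y' d' m' f') = chain_graph Y d m f"
    using surj by (auto simp: app_iso_def induced_iso_def chain_graph_def nodes_def nodes'_def)
qed


section \<open>Chains near the global attractor\<close>

text \<open>Only \<open>a\<close> has to lie in \<open>K\<close>, because chain points near a
  compact set may leave it. The bound is a Lebesgue number of the cover of \<open>K\<close> by
  preimages of balls of radius \<open>\<eta> / 2\<close>.\<close>

lemma (in Metric_space) compact_uniformly_continuous_map:
  assumes K: "compactin mtopology K"
    and g: "continuous_map mtopology mtopology g" and \<eta>: "\<eta> > 0"
  shows "\<exists>\<delta>>0. \<forall>a\<in>K. \<forall>b\<in>M. d a b < \<delta> \<longrightarrow> d (g a) (g b) < \<eta>"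
proof -
  define U where "U = (\<lambda>z. {x \<in> M. g x \<in> mball z (\<eta> / 2)})"
  have "K \<subseteq> M"
    using compactin_subset_topspace[OF K] by simp
  have gM: "g x \<in> M" if "x \<in> M" for x
    using continuous_map_funspace[OF g] that by auto
  have "openin mtopology (U z)" for z
    using openin_continuous_map_preimage[OF g openin_mball, of z "\<eta> / 2"] by (simp only: U_def topspace_mtopology)
  moreover have "K \<subseteq> \<Union>(U ` M)"
    using \<open>K \<subseteq> M\<close> gM \<eta> by (force simp: U_def)
  ultimately obtain \<delta> where \<delta>: "\<delta> > 0" "\<forall>x\<in>K. \<exists>V\<in>U ` M. mball x \<delta> \<subseteq> V"
    using lebesgue_number[OF K, of "U ` M"] by auto
  have "d (g a) (g b) < \<eta>" if "a \<in> K" "b \<in> M" "d a b < \<delta>" for a b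
  proof -
    have "a \<in> M"
      using that \<open>K \<subseteq> M\<close> by auto
    obtain z where z: "z \<in> M" "mball a \<delta> \<subseteq> U z"
      using \<delta>(2) \<open>a \<in> K\<close> by blast
    have "a \<in> U z" "b \<in> U z"
      using z \<open>a \<in> M\<close> that \<delta>(1) by auto
    then have "d z (g a) < \<eta> / 2" "d z (g b) < \<eta> / 2" "g a \<in> M" "g b \<in> M"
      by (auto simp: U_def)
    then show ?thesis
      using triangle[of "g a" z "g b"] z(1) commute[of "g a" z] by linarith
  qed
  with \<delta>(1) show ?thesis by blast
qed

lemma (in Metric_space) compact_uniformly_continuous_family:
  assumes K: "compactin mtopology K"
    and f: "\<forall>i\<in>{1..m::nat}. continuous_map mtopology mtopology (f i)" and \<eta>: "\<eta> > 0"
  shows "\<exists>\<delta>>0. \<forall>i\<in>{1..m}. \<forall>a\<in>K. \<forall>b\<in>M. d a b < \<delta> \<longrightarrow> d (f i a) (f i b) < \<eta>"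
proof -
  obtain \<delta> where \<delta>: "\<And>i. i \<in> {1..m} \<Longrightarrow> \<delta> i > 0 \<and>
      (\<forall>a\<in>K. \<forall>b\<in>M. d a b < \<delta> i \<longrightarrow> d (f i a) (f i b) < \<eta>)"
    using compact_uniformly_continuous_map[OF K bspec[OF f] \<eta>] by metis
  \<comment> \<open>Inserting 1 keeps the set nonempty for every \<open>m\<close>.\<close>
  define e where "e = Min (insert 1 (\<delta> ` {1..m}))"
  have "e > 0"
    unfolding e_def using \<delta> by (subst Min_gr_iff) auto
  moreover have "e \<le> \<delta> i" if "i \<in> {1..m}" for i
    unfolding e_def using that by (intro Min_le) auto
  ultimately show ?thesis
    using \<delta> by (meson less_le_trans)
qed

text \<open>Local compactness enters here. Finitely many open sets with compact supersets cover
  \<open>G\<close>; a Lebesgue number of the one-element cover by their union is the uniform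
  radius.\<close>

lemma (in Metric_space) compact_neighbourhood_radius:
  assumes "locally_compact_space mtopology" and G: "compactin mtopology G"
  shows "\<exists>K r. compactin mtopology K \<and> r > 0 \<and> nbhd M d r G \<subseteq> K"
proof -
  have "G \<subseteq> M"
    using compactin_subset_topspace[OF G] by simp
  then obtain U C where UC: "\<And>a. a \<in> G \<Longrightarrow>
      openin mtopology (U a) \<and> compactin mtopology (C a) \<and> a \<in> U a \<and> U a \<subseteq> C a"
    using assms(1) unfolding locally_compact_space_def by (metis subsetD topspace_mtopology)
  obtain F where F: "finite F" "F \<subseteq> U ` G" "G \<subseteq> \<Union>F"
    using compactinD[OF G, of "U ` G"] UC by blast
  then obtain S where S: "finite S" "S \<subseteq> G" "F = U ` S"
    by (meson finite_subset_image)
  have "openin mtopology (\<Union>F)"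
    using S UC by (intro openin_Union) auto
  then obtain r where r: "r > 0" "\<And>x. x \<in> G \<Longrightarrow> mball x r \<subseteq> \<Union>F"
    using lebesgue_number[OF G, of "{\<Union>F}"] F(3) by auto
  have "compactin mtopology (\<Union>(C ` S))"
    using S UC by (intro compactin_Union) auto
  moreover have "nbhd M d r G \<subseteq> \<Union>F"
  proof
    fix x assume "x \<in> nbhd M d r G"
    then obtain a where "x \<in> M" "a \<in> G" "d x a < r"
      by (auto simp: nbhd_def)
    then have "x \<in> mball a r"
      using \<open>G \<subseteq> M\<close> by (auto simp: commute)
    then show "x \<in> \<Union>F"
      using r(2) \<open>a \<in> G\<close> by blast
  qed
  moreover have "\<Union>F \<subseteq> \<Union>(C ` S)"
    using S UC by blast
  ultimately show ?thesis
    using r(1) by blast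
qed

section \<open>Shadowing of chains by true orbits\<close>

lemma word_map_snoc: "word_map f (map i [0..<Suc n]) x = f (i n) (word_map f (map i [0..<n]) x)"
  by (simp add: word_map_def)

context
  fixes M :: "'a set" and d :: "'a \<Rightarrow> 'a \<Rightarrow> real" and m :: nat and f :: "nat \<Rightarrow> 'a \<Rightarrow> 'a"
  assumes ifs: "IFS M d m f"
begin

interpretation Metric_space M d
  using ifs by (simp add: IFS_def)

lemma IFS_continuous: "\<forall>i\<in>{1..m}. continuous_map mtopology mtopology (f i)"
  using ifs by (simp add: IFS_def)

lemma IFS_closed: "i \<in> {1..m} \<Longrightarrow> x \<in> M \<Longrightarrow> f i x \<in> M"
  using continuous_map_funspace[OF bspec[OF IFS_continuous]] by auto

lemma compactin_hutchinson:
  "compactin mtopology K \<Longrightarrow> compactin mtopology (hutchinson m f K)"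
  unfolding hutchinson_def
  using IFS_continuous by (intro compactin_Union) (auto intro: image_compactin)

lemma compactin_hutchinson_pow:
  "compactin mtopology K \<Longrightarrow> compactin mtopology ((hutchinson m f ^^ n) K)"
  by (induction n) (auto intro: compactin_hutchinson)

lemma word_map_in_hutchinson_pow:
  assumes "x \<in> K" and "\<And>n. n < k \<Longrightarrow> i n \<in> {1..m}"
  shows "word_map f (map i [0..<k]) x \<in> (hutchinson m f ^^ k) K"
  using assms(2)
proof (induction k)
  case 0
  then show ?case using assms(1) by (simp add: word_map_def)
next
  case (Suc k)
  then have "word_map f (map i [0..<k]) x \<in> (hutchinson m f ^^ k) K" "i k \<in> {1..m}"
    by auto
  then show ?case
    unfolding word_map_snoc funpow.simps comp_apply hutchinson_def by blast
qed

text \<open>Induction on the length bound. Orbits of length \<open>n\<close> from \<open>K\<close>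
  end in a compact iterate of \<open>K\<close> under the Hutchinson map, where the maps are
  uniformly continuous; the next map then turns the old error into less than
  \<open>\<eta> / 2\<close>, and the new jump adds less than \<open>\<eta> / 2\<close>. The
  precision depends on \<open>n\<close>.\<close>

lemma chain_path_shadow:
  assumes K: "compactin mtopology K" and "\<eta> > 0"
  shows "\<exists>\<epsilon>>0. \<forall>k p i. chain_path M d m f \<epsilon> k p i \<longrightarrow> p 0 \<in> K \<longrightarrow> k \<le> n \<longrightarrow>
    d (p k) (word_map f (map i [0..<k]) (p 0)) < \<eta>"
  using \<open>\<eta> > 0\<close>
proof (induction n arbitrary: \<eta>)
  case 0
  then show ?case
    by (intro exI[of _ 1]) (auto simp: word_map_def chain_path_def)
next
  case (Suc n)
  let ?H = "(hutchinson m f ^^ n) K"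
  obtain \<delta> where \<delta>: "\<delta> > 0"
    "\<And>i a b. i \<in> {1..m} \<Longrightarrow> a \<in> ?H \<Longrightarrow> b \<in> M \<Longrightarrow> d a b < \<delta> \<Longrightarrow> d (f i a) (f i b) < \<eta> / 2"
    using compact_uniformly_continuous_family[OF compactin_hutchinson_pow[OF K]
        IFS_continuous half_gt_zero[OF \<open>\<eta> > 0\<close>]] by metis
  obtain \<epsilon> where \<epsilon>: "\<epsilon> > 0"
    "\<And>k p i. chain_path M d m f \<epsilon> k p i \<Longrightarrow> p 0 \<in> K \<Longrightarrow> k \<le> n \<Longrightarrow>
      d (p k) (word_map f (map i [0..<k]) (p 0)) < min \<eta> \<delta>"
    \<comment> \<open>The bound \<open>\<eta>\<close> settles chains of length at most
      \<open>n\<close>; \<open>\<delta>\<close> prepares the step to \<open>Suc n\<close>.\<close>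
    using Suc.IH[of "min \<eta> \<delta>"] Suc.prems \<delta>(1) by auto
  have "d (p k) (word_map f (map i [0..<k]) (p 0)) < \<eta>"
    if p: "chain_path M d m f (min \<epsilon> (\<eta> / 2)) k p i" "p 0 \<in> K" "k \<le> Suc n" for k p i
  proof (cases "k \<le> n")
    case True
    then show ?thesis
      using \<epsilon>(2)[of k p i] chain_path_mono[OF p(1)] p(2) by auto
  next
    case False
    then have k: "k = Suc n" using p(3) by simp
    define w where "w = word_map f (map i [0..<n]) (p 0)"
    have i: "i j \<in> {1..m}" if "j < k" for j
      using p(1) that by (auto simp: chain_path_def)
    have w: "w \<in> ?H"
      unfolding w_def using p(2) i k by (intro word_map_in_hutchinson_pow) auto
    then have "w \<in> M"
      using compactin_subset_topspace[OF compactin_hutchinson_pow[OF K, of n]] by auto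
    have pM: "p n \<in> M" "p k \<in> M"
      using p(1) k by (auto simp: chain_path_def)
    have "chain_path M d m f \<epsilon> n p i"
      using chain_path_mono[OF chain_path_take[OF p(1)]] k by auto
    then have "d w (p n) < \<delta>"
      using \<epsilon>(2)[of n p i] p(2) by (auto simp: w_def commute)
    then have 1: "d (f (i n) w) (f (i n) (p n)) < \<eta> / 2"
      using \<delta>(2) i k w pM by auto
    have 2: "d (f (i n) (p n)) (p k) < \<eta> / 2"
      using p(1) k by (auto simp: chain_path_def)
    have "f (i n) w \<in> M" "f (i n) (p n) \<in> M"
      using IFS_closed i k \<open>w \<in> M\<close> pM by auto
    then have "d (f (i n) w) (p k) < \<eta>"
      using 1 2 triangle[of "f (i n) w" "f (i n) (p n)" "p k"] pM by auto
    then show ?thesis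
      unfolding k word_map_snoc using k by (simp add: w_def commute)
  qed
  then show ?case
    using \<epsilon>(1) Suc.prems by (intro exI[of _ "min \<epsilon> (\<eta> / 2)"]) auto
qed

section \<open>Trapping of chains near the attractor\<close>

context
  fixes G :: "'a set"
  assumes attractor: "global_attractor M d m f G"
begin

lemma attractor_compact: "compactin mtopology G"
  using attractor by (simp add: global_attractor_def)

lemma attractor_subset: "G \<subseteq> M"
  using compactin_subset_topspace[OF attractor_compact] by simp

lemma attractor_invariant: "i \<in> {1..m} \<Longrightarrow> x \<in> G \<Longrightarrow> f i x \<in> G"
  using attractor unfolding global_attractor_def hutchinson_def by blast

text \<open>
  Blocks of length \<open>\<tau>\<close> that start in \<open>K\<close> follow true orbits and so return to the neighbourhood
  of \<open>G\<close> inside \<open>K\<close>; hence the same \<open>\<epsilon>\<close> controls chains of every length.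
\<close>

lemma chain_path_attracted:
  assumes K: "compactin mtopology K" and r: "r > 0" "nbhd M d r G \<subseteq> K" and \<eta>: "\<eta> > 0"
  shows "\<exists>\<epsilon>>0. \<exists>\<tau>>0. \<forall>k p i. chain_path M d m f \<epsilon> k p i \<longrightarrow> p 0 \<in> K \<longrightarrow> k \<ge> \<tau> \<longrightarrow>
    p k \<in> nbhd M d \<eta> G"
proof -
  \<comment> \<open>The orbit is within \<open>e\<close> of \<open>G\<close> and the chain within
    \<open>e\<close> of the orbit. The sum \<open>2 * e\<close> is at most \<open>r\<close>, which
    leads back into \<open>K\<close>, and at most \<open>\<eta>\<close>.\<close>
  define e where "e = min r \<eta> / 2"
  have "e > 0" using r \<eta> by (simp add: e_def)
  have "attracts M d m f G K"
    using attractor K by (simp add: global_attractor_def)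
  then obtain \<tau> where \<tau>: "\<tau> > 0"
    "\<And>I. I \<in> lists {1..m} \<Longrightarrow> length I \<ge> \<tau> \<Longrightarrow> word_map f I ` K \<subseteq> nbhd M d e G"
    unfolding attracts_def using \<open>e > 0\<close> by meson
  \<comment> \<open>Lengths from \<open>\<tau>\<close> to \<open>2 * \<tau>\<close> are treated
    directly. From a longer chain one block of length \<open>\<tau>\<close> is cut off, and more
    than \<open>\<tau>\<close> steps remain for the induction.\<close>
  obtain \<epsilon> where \<epsilon>: "\<epsilon> > 0"
    "\<And>k p i. chain_path M d m f \<epsilon> k p i \<Longrightarrow> p 0 \<in> K \<Longrightarrow> k \<le> 2 * \<tau> \<Longrightarrow>
      d (p k) (word_map f (map i [0..<k]) (p 0)) < e"
    using chain_path_shadow[OF K \<open>e > 0\<close>, of "2 * \<tau>"] by metis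
  have short: "p k \<in> nbhd M d (2 * e) G"
    if p: "chain_path M d m f \<epsilon> k p i" "p 0 \<in> K" "k \<ge> \<tau>" "k \<le> 2 * \<tau>" for k p i
  proof -
    define w where "w = word_map f (map i [0..<k]) (p 0)"
    have "map i [0..<k] \<in> lists {1..m}"
      using p(1) by (auto simp: chain_path_def)
    then have "w \<in> nbhd M d e G"
      using \<tau>(2)[of "map i [0..<k]"] p by (auto simp: w_def)
    then obtain a where a: "w \<in> M" "a \<in> G" "d w a < e"
      by (auto simp: nbhd_def)
    have "p k \<in> M" "a \<in> M" "d (p k) w < e"
      using p \<epsilon>(2)[of k p i] a attractor_subset by (auto simp: chain_path_def w_def)
    then have "d (p k) a < 2 * e"
      using triangle[of "p k" w a] a by auto
    then show ?thesis
      using a \<open>p k \<in> M\<close> by (auto simp: nbhd_def)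
  qed
  have "p k \<in> nbhd M d (2 * e) G"
    if "chain_path M d m f \<epsilon> k p i" "p 0 \<in> K" "k \<ge> \<tau>" for k p i
    using that
  proof (induction k arbitrary: p i rule: less_induct)
    case (less k)
    show ?case
    proof (cases "k \<le> 2 * \<tau>")
      case True
      then show ?thesis using short less.prems by blast
    next
      case False
      have "p \<tau> \<in> nbhd M d (2 * e) G"
        using short[of \<tau> p i] chain_path_take[OF less.prems(1,3)] less.prems(2) by auto
      then have "p \<tau> \<in> K"
        using r(2) unfolding nbhd_def e_def by force
      then have "p (k - \<tau> + \<tau>) \<in> nbhd M d (2 * e) G"
        using less.IH[of "k - \<tau>" "\<lambda>n. p (n + \<tau>)" "\<lambda>n. i (n + \<tau>)"] False \<tau>(1)
          chain_path_drop[OF less.prems(1,3)] by auto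
      then show ?thesis using less.prems(3) by simp
    qed
  qed
  moreover have "nbhd M d (2 * e) G \<subseteq> nbhd M d \<eta> G"
    unfolding nbhd_def e_def by force
  ultimately show ?thesis
    using \<epsilon>(1) \<tau>(1) by blast
qed

section \<open>Recurrent points and chains inside the attractor\<close>

context
  assumes loc_compact: "locally_compact_space mtopology"
begin

text \<open>A loop at \<open>x\<close>, repeated often enough, is an attracted chain that ends at
  \<open>x\<close>. So \<open>x\<close> is arbitrarily close to the closed set
  \<open>G\<close>.\<close>

lemma chain_recurrent_in_attractor: "chain_recurrent_set M d m f \<subseteq> G"
proof
  fix x assume x: "x \<in> chain_recurrent_set M d m f"
  then have "x \<in> M" by (simp add: chain_recurrent_set_def)
  obtain K r where K: "compactin mtopology K" "r > 0" "nbhd M d r G \<subseteq> K"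
    using compact_neighbourhood_radius[OF loc_compact attractor_compact] by blast
  \<comment> \<open>The loop starts at \<open>x\<close>, which need not lie in the compact
    neighbourhood of \<open>G\<close>.\<close>
  have K': "compactin mtopology (insert x K)"
    using compactin_Un[OF _ K(1), of "{x}"] \<open>x \<in> M\<close> by simp
  have near: "\<exists>a\<in>G. d x a < \<eta>" if "\<eta> > 0" for \<eta>
  proof -
    obtain \<epsilon> \<tau> where *: "\<epsilon> > 0" "\<And>k p i. chain_path M d m f \<epsilon> k p i \<Longrightarrow> p 0 \<in> insert x K \<Longrightarrow>
        k \<ge> \<tau> \<Longrightarrow> p k \<in> nbhd M d \<eta> G"
      using chain_path_attracted[OF K' K(2) _ \<open>\<eta> > 0\<close>] K(3) by (metis subset_insertI2)
    obtain k p i where "k \<ge> 1" "p 0 = x" "p k = x" "chain_path M d m f \<epsilon> k p i"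
      using chain_recurrent_loop[OF x _ *(1)] by auto
    then obtain l q j where "l \<ge> \<tau>" "q 0 = x" "q l = x" "chain_path M d m f \<epsilon> l q j"
      using chain_path_repeat[of M d m f \<epsilon> k p i x \<tau>] by metis
    then show ?thesis
      using *(2)[of l q j] by (auto simp: nbhd_def)
  qed
  have "closedin mtopology G"
    using compactin_imp_closedin[OF Hausdorff_space_mtopology attractor_compact] .
  show "x \<in> G"
  proof (rule ccontr)
    assume "x \<notin> G"
    then obtain \<eta> where "\<eta> > 0" "disjnt G (mball x \<eta>)"
      using \<open>closedin mtopology G\<close> \<open>x \<in> M\<close> unfolding closedin_metric by blast
    then show False
      using near[of \<eta>] \<open>x \<in> M\<close> attractor_subset by (auto simp: disjnt_iff)
  qed
qed

text \<open>Long chains are attracted. Short ones shadow orbits that start in \<open>G\<close> and,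
  by invariance, remain there.\<close>

lemma chain_path_stays_near_attractor:
  assumes \<eta>: "\<eta> > 0"
  shows "\<exists>\<epsilon>>0. \<forall>k p i. chain_path M d m f \<epsilon> k p i \<longrightarrow> p 0 \<in> G \<longrightarrow> p k \<in> nbhd M d \<eta> G"
proof -
  obtain K r where K: "compactin mtopology K" "r > 0" "nbhd M d r G \<subseteq> K"
    using compact_neighbourhood_radius[OF loc_compact attractor_compact] by blast
  have "G \<subseteq> K"
    using K attractor_subset by (force simp: nbhd_def)
  obtain \<epsilon> \<tau> where 1: "\<epsilon> > 0" "\<And>k p i. chain_path M d m f \<epsilon> k p i \<Longrightarrow> p 0 \<in> K \<Longrightarrow>
      k \<ge> \<tau> \<Longrightarrow> p k \<in> nbhd M d \<eta> G"
    using chain_path_attracted[OF K \<eta>] by metis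
  obtain \<epsilon>' where 2: "\<epsilon>' > 0" "\<And>k p i. chain_path M d m f \<epsilon>' k p i \<Longrightarrow> p 0 \<in> G \<Longrightarrow> k \<le> \<tau> \<Longrightarrow>
      d (p k) (word_map f (map i [0..<k]) (p 0)) < \<eta>"
    using chain_path_shadow[OF attractor_compact \<eta>, of \<tau>] by metis
  have "p k \<in> nbhd M d \<eta> G" if p: "chain_path M d m f (min \<epsilon> \<epsilon>') k p i" "p 0 \<in> G" for k p i
  proof (cases "k \<ge> \<tau>")
    case True
    then show ?thesis
      using 1(2)[of k p i] chain_path_mono[OF p(1)] p(2) \<open>G \<subseteq> K\<close> by auto
  next
    case False
    have "(hutchinson m f ^^ k) G = G"
      using attractor by (induction k) (auto simp: global_attractor_def)
    then have "word_map f (map i [0..<k]) (p 0) \<in> G"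
      using word_map_in_hutchinson_pow[OF p(2), of k i] p(1) by (auto simp: chain_path_def)
    then show ?thesis
      using 2(2)[of k p i] chain_path_mono[OF p(1)] p False
      by (auto simp: nbhd_def chain_path_def)
  qed
  then show ?thesis
    using 1(1) 2(1) by (intro exI[of _ "min \<epsilon> \<epsilon>'"]) auto
qed

text \<open>From \<open>M\<close> to \<open>G\<close>, each point of a fine chain is moved to a
  nearby point of \<open>G\<close>. A new step has three errors below \<open>\<epsilon> / 3\<close>:
  moving the start, seen through the map; the old jump; moving the target.\<close>

lemma chain_ge_attractor_iff:
  assumes "x \<in> G" "y \<in> G"
  shows "chain_ge G d m f x y \<longleftrightarrow> chain_ge M d m f x y"
proof
  assume "chain_ge G d m f x y"
  moreover have "chain_path G d m f \<epsilon> k p i \<Longrightarrow> chain_path M d m f \<epsilon> k p i" for \<epsilon> k p i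
    using attractor_subset by (auto simp: chain_path_def)
  ultimately show "chain_ge M d m f x y"
    unfolding chain_ge_def eps_chain_iff by meson
next
  assume ge: "chain_ge M d m f x y"
  show "chain_ge G d m f x y"
    unfolding chain_ge_def
  proof (intro allI impI)
    fix \<epsilon> :: real assume "\<epsilon> > 0"
    then have "\<epsilon> / 3 > 0" by simp
    obtain \<delta> where \<delta>: "\<delta> > 0"
      "\<And>i a b. i \<in> {1..m} \<Longrightarrow> a \<in> G \<Longrightarrow> b \<in> M \<Longrightarrow> d a b < \<delta> \<Longrightarrow> d (f i a) (f i b) < \<epsilon> / 3"
      using compact_uniformly_continuous_family[OF attractor_compact IFS_continuous \<open>\<epsilon> / 3 > 0\<close>]
      by metis
    define \<eta> where "\<eta> = min \<delta> (\<epsilon> / 3)"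
    have "\<eta> > 0" using \<delta>(1) \<open>\<epsilon> > 0\<close> by (simp add: \<eta>_def)
    obtain \<epsilon>' where \<epsilon>': "\<epsilon>' > 0"
      "\<And>k p i. chain_path M d m f \<epsilon>' k p i \<Longrightarrow> p 0 \<in> G \<Longrightarrow> p k \<in> nbhd M d \<eta> G"
      using chain_path_stays_near_attractor[OF \<open>\<eta> > 0\<close>] by metis
    have "min \<epsilon>' (\<epsilon> / 3) > 0" using \<epsilon>'(1) \<open>\<epsilon> > 0\<close> by simp
    then obtain k p i where p: "p 0 = x" "p k = y" "chain_path M d m f (min \<epsilon>' (\<epsilon> / 3)) k p i"
      using ge unfolding chain_ge_def eps_chain_iff by metis
    \<comment> \<open>Points already in \<open>G\<close> are left in place, so the chain still runs
      from \<open>x\<close> to \<open>y\<close>.\<close>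
    have "\<exists>a\<in>G. d (p n) a < \<eta> \<and> (p n \<in> G \<longrightarrow> a = p n)" if "n \<le> k" for n
    proof (cases "p n \<in> G")
      case True
      then show ?thesis using attractor_subset \<open>\<eta> > 0\<close> by (intro bexI[of _ "p n"]) auto
    next
      case False
      have "chain_path M d m f \<epsilon>' n p i"
        using chain_path_mono[OF chain_path_take[OF p(3) that]] by auto
      then show ?thesis
        using \<epsilon>'(2)[of n p i] p(1) assms(1) False by (auto simp: nbhd_def)
    qed
    then obtain q where q: "\<And>n. n \<le> k \<Longrightarrow> q n \<in> G \<and> d (p n) (q n) < \<eta> \<and> (p n \<in> G \<longrightarrow> q n = p n)"
      by metis
    have "chain_path G d m f \<epsilon> k q i"
      unfolding chain_path_def
    proof (intro conjI allI impI)
      fix n assume n: "n < k"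
      have i: "i n \<in> {1..m}" and step: "d (f (i n) (p n)) (p (Suc n)) < \<epsilon> / 3"
        using p(3) n by (auto simp: chain_path_def)
      show "i n \<in> {1..m}" by (rule i)
      have M: "p n \<in> M" "p (Suc n) \<in> M" "q n \<in> M" "q (Suc n) \<in> M"
        using p(3) q[of n] q[of "Suc n"] n attractor_subset by (auto simp: chain_path_def)
      have fM: "f (i n) (p n) \<in> M" "f (i n) (q n) \<in> M"
        using IFS_closed[OF i] M by auto
      have "d (q n) (p n) < \<delta>"
        using q[of n] n by (auto simp: commute \<eta>_def)
      then have "d (f (i n) (q n)) (f (i n) (p n)) < \<epsilon> / 3"
        using \<delta>(2)[OF i] q[of n] n M by auto
      moreover have "d (p (Suc n)) (q (Suc n)) < \<epsilon> / 3"
        using q[of "Suc n"] n by (auto simp: \<eta>_def)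
      ultimately show "d (f (i n) (q n)) (q (Suc n)) < \<epsilon>"
        using step triangle[of "f (i n) (q n)" "f (i n) (p n)" "q (Suc n)"]
          triangle[of "f (i n) (p n)" "p (Suc n)" "q (Suc n)"] M fM by linarith
    qed (use q in auto)
    moreover have "q 0 = x" "q k = y"
      using q[of 0] q[of k] p(1,2) assms by auto
    ultimately show "eps_chain G d m f \<epsilon> x y"
      unfolding eps_chain_iff by blast
  qed
qed

lemma chain_recurrent_set_attractor:
  "chain_recurrent_set G d m f = chain_recurrent_set M d m f"
proof -
  have "chain_equiv G d m f x (f i x) \<longleftrightarrow> chain_equiv M d m f x (f i x)"
    if "x \<in> G" "i \<in> {1..m}" for x i
    using that attractor_invariant by (simp add: chain_equiv_def chain_ge_attractor_iff)
  then show ?thesis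
    using chain_recurrent_in_attractor attractor_subset
    unfolding chain_recurrent_set_def by blast
qed

end

end

end


section \<open>Chains of the skew product\<close>

text \<open>The strict inequality puts the first difference beyond index \<open>L\<close>, so
  \<open>L + 1\<close> letters agree.\<close>

lemma dist_shift_less_power_iff: "dist_shift \<omega> \<nu> < (1/2) ^ L \<longleftrightarrow> (\<forall>n\<le>L. \<omega> n = \<nu> n)"
proof (cases "\<omega> = \<nu>")
  case False
  then obtain j where "\<omega> j \<noteq> \<nu> j" by blast
  then have j: "\<omega> (LEAST j. \<omega> j \<noteq> \<nu> j) \<noteq> \<nu> (LEAST j. \<omega> j \<noteq> \<nu> j)"
    by (rule LeastI)
  have "dist_shift \<omega> \<nu> < (1/2) ^ L \<longleftrightarrow> L < (LEAST j. \<omega> j \<noteq> \<nu> j)"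
    using False by (simp add: dist_shift_def)
  also have "\<dots> \<longleftrightarrow> (\<forall>n\<le>L. \<omega> n = \<nu> n)"
    using j not_less_Least[of _ "\<lambda>j. \<omega> j \<noteq> \<nu> j"] by (meson le_less_trans not_less)
  finally show ?thesis .
qed (simp add: dist_shift_def)

lemma dist_shift_self: "dist_shift \<omega> \<omega> = 0"
  by (simp add: dist_shift_def)

lemma shift_in_full_shift: "\<omega> \<in> full_shift m \<Longrightarrow> (\<lambda>n. \<omega> (n + k)) \<in> full_shift m"
  by (simp add: full_shift_def)

text \<open>Expresses chains of the skew product starting at \<open>(\<omega>, x)\<close> through
  \<open>f\<close> alone. The demand \<open>k \<ge> L\<close> makes the \<open>L\<close> prescribed
  letters belong to actual steps.\<close>

definition chain_along ::
  "'a set \<Rightarrow> ('a \<Rightarrow> 'a \<Rightarrow> real) \<Rightarrow> nat \<Rightarrow> (nat \<Rightarrow> 'a \<Rightarrow> 'a) \<Rightarrow> (nat \<Rightarrow> nat) \<Rightarrow> 'a \<Rightarrow> 'a \<Rightarrow> bool" where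
  "chain_along Y d m f \<omega> x y \<longleftrightarrow>
     (\<forall>\<epsilon>>0. \<forall>L. \<exists>k\<ge>L. \<exists>p i. p 0 = x \<and> p k = y \<and> chain_path Y d m f \<epsilon> k p i \<and> (\<forall>n<L. i n = \<omega> n))"

lemma chain_along_ge_trans:
  assumes xy: "chain_along Y d m f \<omega> x y" and yz: "chain_ge Y d m f y z"
  shows "chain_along Y d m f \<omega> x z"
  unfolding chain_along_def
proof (intro allI impI)
  fix \<epsilon> :: real and L :: nat
  assume "\<epsilon> > 0"
  then obtain k p i l q j
    where p: "k \<ge> L" "p 0 = x" "p k = y" "chain_path Y d m f \<epsilon> k p i" "\<forall>n<L. i n = \<omega> n"
      and q: "q 0 = y" "q l = z" "chain_path Y d m f \<epsilon> l q j"
    using xy yz unfolding chain_along_def chain_ge_def eps_chain_iff by meson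
  define r s where "r = (\<lambda>n. if n < k then p n else q (n - k))"
    and "s = (\<lambda>n. if n < k then i n else j (n - k))"
  have "chain_path Y d m f \<epsilon> (k + l) r s"
    unfolding r_def s_def using p q by (intro chain_path_append) auto
  moreover have "r 0 = x" "r (k + l) = z" "\<forall>n<L. s n = \<omega> n" "L \<le> k + l"
    using p q by (auto simp: r_def s_def)
  ultimately show "\<exists>k\<ge>L. \<exists>p i. p 0 = x \<and> p k = z \<and> chain_path Y d m f \<epsilon> k p i \<and>
      (\<forall>n<L. i n = \<omega> n)"
    by blast
qed

section \<open>The skew product over a space \<open>Y\<close>, later taken to be the
  attractor\<close>

context
  fixes Y :: "'a set" and d :: "'a \<Rightarrow> 'a \<Rightarrow> real" and m :: nat and f :: "nat \<Rightarrow> 'a \<Rightarrow> 'a"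
  assumes metric: "Metric_space Y d"
    and closed: "\<And>i x. i \<in> {1..m} \<Longrightarrow> x \<in> Y \<Longrightarrow> f i x \<in> Y"
    and cont: "\<And>i x \<eta>. i \<in> {1..m} \<Longrightarrow> x \<in> Y \<Longrightarrow> \<eta> > 0 \<Longrightarrow>
      \<exists>\<delta>>0. \<forall>y\<in>Y. d x y < \<delta> \<longrightarrow> d (f i x) (f i y) < \<eta>"
begin

interpretation Metric_space Y d
  by (rule metric)

abbreviation (input) "skew_space \<equiv> full_shift m \<times> Y"
abbreviation (input) "skew_dist \<equiv> max_dist dist_shift d"
abbreviation (input) "skew_ge \<equiv> chain_ge skew_space skew_dist 1 (\<lambda>_. skew_product f)"
abbreviation (input) "skew_recurrent \<equiv>
  chain_recurrent_set skew_space skew_dist 1 (\<lambda>_. skew_product f)"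

lemma skew_dist_self: "p \<in> skew_space \<Longrightarrow> skew_dist p p = 0"
  by (auto simp: max_dist_def dist_shift_self)

lemma skew_product_closed: "p \<in> skew_space \<Longrightarrow> skew_product f p \<in> skew_space"
  using closed by (auto simp: skew_product_def full_shift_def)

text \<open>The projection does not increase distances, and the letter applied at time
  \<open>n\<close> is the first letter of the current sequence.\<close>

lemma chain_ge_snd:
  assumes "skew_ge p q"
  shows "chain_ge Y d m f (snd p) (snd q)"
  unfolding chain_ge_def
proof (intro allI impI)
  fix \<epsilon> :: real assume "\<epsilon> > 0"
  then obtain k P j where P: "P 0 = p" "P k = q"
    "chain_path skew_space skew_dist 1 (\<lambda>_. skew_product f) \<epsilon> k P j"
    using assms unfolding chain_ge_def eps_chain_iff by blast
  have "chain_path Y d m f \<epsilon> k (snd \<circ> P) (\<lambda>n. fst (P n) 0)"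
    unfolding chain_path_def
  proof (intro conjI allI impI)
    fix n assume "n \<le> k"
    then have "P n \<in> skew_space" using P(3) by (auto simp: chain_path_def)
    then show "(snd \<circ> P) n \<in> Y" by auto
  next
    fix n assume n: "n < k"
    then have "P n \<in> skew_space" "skew_dist (skew_product f (P n)) (P (Suc n)) < \<epsilon>"
      using P(3) by (auto simp: chain_path_def)
    then show "fst (P n) 0 \<in> {1..m}" "d (f (fst (P n) 0) ((snd \<circ> P) n)) ((snd \<circ> P) (Suc n)) < \<epsilon>"
      by (auto simp: full_shift_def max_dist_def skew_product_def split: prod.splits)
  qed
  then show "eps_chain Y d m f \<epsilon> (snd p) (snd q)"
    using P(1,2) unfolding eps_chain_iff by (metis comp_apply)
qed

text \<open>
  Append \<open>\<nu>\<close> to the letters of a chain from \<open>x\<close> to \<open>y\<close>: along the resulting sequence the shift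
  coordinate moves exactly, except for the first step, which starts at \<open>\<omega>\<close> instead.
\<close>

lemma skew_ge_if_chain_along:
  assumes \<omega>: "\<omega> \<in> full_shift m" and \<nu>: "\<nu> \<in> full_shift m" and xy: "chain_along Y d m f \<omega> x y"
  shows "skew_ge (\<omega>, x) (\<nu>, y)"
  unfolding chain_ge_def
proof (intro allI impI)
  fix \<epsilon> :: real assume "\<epsilon> > 0"
  then obtain L where L: "(1/2) ^ L < \<epsilon>"
    using real_arch_pow_inv[of \<epsilon> "1/2"] by auto
  \<comment> \<open>After the shift, the first jump compares indices 1 to \<open>L + 1\<close> of
    \<open>\<omega>\<close> and \<open>W\<close>, hence \<open>L + 2\<close> letters. Moreover
    \<open>k > 0\<close>, so the chain ends at the sequence \<open>\<nu>\<close>.\<close>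
  obtain k p i where k: "k \<ge> L + 2" and p: "p 0 = x" "p k = y" "chain_path Y d m f \<epsilon> k p i"
    and i: "\<forall>n<L + 2. i n = \<omega> n"
    using xy \<open>\<epsilon> > 0\<close> unfolding chain_along_def by meson
  define W where "W = (\<lambda>n. if n < k then i n else \<nu> (n - k))"
  define P where "P = (\<lambda>n. (if n = 0 then \<omega> else (\<lambda>j. W (j + n)), p n))"
  have "W \<in> full_shift m"
    using p(3) \<nu> by (auto simp: W_def full_shift_def chain_path_def)
  then have P_in: "P n \<in> skew_space" if "n \<le> k" for n
    using shift_in_full_shift[of W m n] that \<omega> p(3) by (auto simp: P_def chain_path_def)
  have step: "skew_dist (skew_product f (P n)) (P (Suc n)) < \<epsilon>" if n: "n < k" for n
  proof -
    have "fst (P n) 0 = i n"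
      using n i by (auto simp: P_def W_def)
    moreover have "dist_shift (\<lambda>j. fst (P n) (Suc j)) (fst (P (Suc n))) < \<epsilon>"
    proof (cases "n = 0")
      case True
      have "dist_shift (\<lambda>j. \<omega> (Suc j)) (\<lambda>j. W (Suc j)) < (1/2) ^ L"
        unfolding dist_shift_less_power_iff using i k by (auto simp: W_def)
      then show ?thesis
        using True L by (simp add: P_def)
    qed (use \<open>\<epsilon> > 0\<close> in \<open>simp add: P_def dist_shift_self\<close>)
    moreover have "d (f (i n) (p n)) (p (Suc n)) < \<epsilon>"
      using p(3) n by (auto simp: chain_path_def)
    ultimately show ?thesis
      by (auto simp: P_def max_dist_def skew_product_def)
  qed
  have "chain_path skew_space skew_dist 1 (\<lambda>_. skew_product f) \<epsilon> k P (\<lambda>_. 1)"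
    unfolding chain_path_def using P_in step by simp
  moreover have "P 0 = (\<omega>, x)" "P k = (\<nu>, y)"
    using p k by (auto simp: P_def W_def)
  ultimately show "eps_chain skew_space skew_dist 1 (\<lambda>_. skew_product f) \<epsilon> (\<omega>, x) (\<nu>, y)"
    unfolding eps_chain_iff by blast
qed

text \<open>A loop of the skew product is repeated up to length \<open>L\<close>. Jumps below
  \<open>(1/2) ^ L\<close> do not disturb the letters that are used first.\<close>

lemma chain_along_if_skew_recurrent:
  assumes rec: "(\<omega>, x) \<in> skew_recurrent"
  shows "chain_along Y d m f \<omega> x x"
  unfolding chain_along_def
proof (intro allI impI)
  fix \<epsilon> :: real and L :: nat
  assume "\<epsilon> > 0"
  define \<delta> where "\<delta> = min \<epsilon> ((1/2) ^ L)"
  have "\<delta> > 0" using \<open>\<epsilon> > 0\<close> by (simp add: \<delta>_def)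
  obtain k0 P0 i0 where "k0 \<ge> 1" "P0 0 = (\<omega>, x)" "P0 k0 = (\<omega>, x)"
    "chain_path skew_space skew_dist 1 (\<lambda>_. skew_product f) \<delta> k0 P0 i0"
    using chain_recurrent_loop[OF rec skew_dist_self \<open>\<delta> > 0\<close>] by metis
  then obtain k P i where k: "k \<ge> L" and P: "P 0 = (\<omega>, x)" "P k = (\<omega>, x)"
    "chain_path skew_space skew_dist 1 (\<lambda>_. skew_product f) \<delta> k P i"
    using chain_path_repeat[of skew_space skew_dist 1 "\<lambda>_. skew_product f" \<delta> k0 P0 i0 "(\<omega>, x)" L]
    by metis
  have P_in: "P n \<in> skew_space" if "n \<le> k" for n
    using P(3) that by (auto simp: chain_path_def)
  have step: "dist_shift (\<lambda>j. fst (P n) (Suc j)) (fst (P (Suc n))) < \<delta>"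
    "d (f (fst (P n) 0) (snd (P n))) (snd (P (Suc n))) < \<delta>" if "n < k" for n
    using P(3) that
    by (auto simp: chain_path_def max_dist_def skew_product_def case_prod_unfold)
  \<comment> \<open>A letter at position \<open>j\<close> at time \<open>n\<close> has moved down
    from position \<open>n + j \<le> L\<close>, always within the range that the jumps leave
    unchanged.\<close>
  have letters: "fst (P n) j = \<omega> (n + j)" if "n + j \<le> L" for n j
    using that
  proof (induction n arbitrary: j)
    case 0
    then show ?case using P(1) by simp
  next
    case (Suc n)
    have "dist_shift (\<lambda>j. fst (P n) (Suc j)) (fst (P (Suc n))) < (1/2) ^ L"
      using step(1)[of n] Suc.prems k by (simp add: \<delta>_def)
    then have "fst (P (Suc n)) j = fst (P n) (Suc j)"
      unfolding dist_shift_less_power_iff using Suc.prems by simp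
    then show ?case
      using Suc.IH[of "Suc j"] Suc.prems by simp
  qed
  have "chain_path Y d m f \<epsilon> k (\<lambda>n. snd (P n)) (\<lambda>n. fst (P n) 0)"
    unfolding chain_path_def
  proof (intro conjI allI impI)
    fix n assume "n \<le> k"
    then show "snd (P n) \<in> Y" using P_in[of n] by auto
  next
    fix n assume n: "n < k"
    then show "fst (P n) 0 \<in> {1..m}"
      using P_in[of n] by (auto simp: full_shift_def)
    show "d (f (fst (P n) 0) (snd (P n))) (snd (P (Suc n))) < \<epsilon>"
      using step(2)[OF n] by (simp add: \<delta>_def)
  qed
  then show "\<exists>k\<ge>L. \<exists>p i. p 0 = x \<and> p k = x \<and> chain_path Y d m f \<epsilon> k p i \<and> (\<forall>n<L. i n = \<omega> n)"
    using k P(1,2) letters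
    by (intro exI[of _ k] conjI exI[of _ "\<lambda>n. snd (P n)"] exI[of _ "\<lambda>n. fst (P n) 0"]) auto
qed

text \<open>The first step is dropped and the chain restarted at the exact image of \<open>x\<close>
  instead of the nearby \<open>p 1\<close>; continuity of the second map at that image absorbs the
  difference.\<close>

lemma chain_along_shift:
  assumes \<omega>: "\<omega> \<in> full_shift m" and x: "x \<in> Y" and xy: "chain_along Y d m f \<omega> x y"
  shows "chain_along Y d m f (\<lambda>n. \<omega> (Suc n)) (f (\<omega> 0) x) y"
  unfolding chain_along_def
proof (intro allI impI)
  fix \<epsilon> :: real and L :: nat
  assume "\<epsilon> > 0"
  let ?z = "f (\<omega> 0) x"
  have \<omega>_in: "\<omega> j \<in> {1..m}" for j
    using \<omega> by (simp add: full_shift_def)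
  have z: "?z \<in> Y" "f (\<omega> 1) ?z \<in> Y"
    using closed \<omega>_in x by auto
  obtain \<delta> where \<delta>: "\<delta> > 0" "\<And>y. y \<in> Y \<Longrightarrow> d ?z y < \<delta> \<Longrightarrow> d (f (\<omega> 1) ?z) (f (\<omega> 1) y) < \<epsilon> / 2"
    using cont[OF \<omega>_in[of 1] z(1) half_gt_zero[OF \<open>\<epsilon> > 0\<close>]] by blast
  have "min \<delta> (\<epsilon> / 2) > 0" using \<delta>(1) \<open>\<epsilon> > 0\<close> by simp
  \<comment> \<open>One letter is lost by the shift; the other extra letter guarantees a second
    step, with letter \<open>\<omega> 1\<close>, even for \<open>L = 0\<close>.\<close>
  then obtain k p i where k: "k \<ge> L + 2" and p: "p 0 = x" "p k = y"
    "chain_path Y d m f (min \<delta> (\<epsilon> / 2)) k p i" and i: "\<forall>n<L + 2. i n = \<omega> n"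
    using xy unfolding chain_along_def by meson
  define q where "q = (\<lambda>n. if n = 0 then ?z else p (Suc n))"
  have pY: "p n \<in> Y" if "n \<le> k" for n
    using p(3) that by (auto simp: chain_path_def)
  have step: "d (f (i n) (p n)) (p (Suc n)) < min \<delta> (\<epsilon> / 2)" if "n < k" for n
    using p(3) that by (auto simp: chain_path_def)
  have "chain_path Y d m f \<epsilon> (k - 1) q (\<lambda>n. i (Suc n))"
    unfolding chain_path_def
  proof (intro conjI allI impI)
    fix n assume "n \<le> k - 1"
    then show "q n \<in> Y" using z pY k by (auto simp: q_def)
  next
    fix n assume n: "n < k - 1"
    then show "i (Suc n) \<in> {1..m}" using p(3) by (auto simp: chain_path_def)
    show "d (f (i (Suc n)) (q n)) (q (Suc n)) < \<epsilon>"
    proof (cases "n = 0")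
      case True
      have p12: "p 1 \<in> Y" "p 2 \<in> Y" "f (\<omega> 1) (p 1) \<in> Y" using pY closed \<omega>_in k by auto
      have "d ?z (p 1) < \<delta>"
        using step[of 0] i p(1) k by simp
      then have "d (f (\<omega> 1) ?z) (f (\<omega> 1) (p 1)) < \<epsilon> / 2"
        using \<delta>(2) p12 by blast
      moreover have "d (f (\<omega> 1) (p 1)) (p 2) < \<epsilon> / 2"
        using step[of 1] i k by (simp add: numeral_2_eq_2)
      ultimately have "d (f (\<omega> 1) ?z) (p 2) < \<epsilon>"
        using triangle[OF z(2) p12(3,2)] by linarith
      then show ?thesis
        using True i by (simp add: q_def numeral_2_eq_2)
    next
      case False
      have "d (f (i (Suc n)) (p (Suc n))) (p (Suc (Suc n))) < \<epsilon> / 2"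
        using step[of "Suc n"] n by simp
      also have "\<dots> < \<epsilon>" using \<open>\<epsilon> > 0\<close> by simp
      finally show ?thesis using False by (simp add: q_def)
    qed
  qed
  moreover have "q 0 = ?z" "q (k - 1) = y" "L \<le> k - 1" "\<forall>n<L. i (Suc n) = \<omega> (Suc n)"
    using k p i by (auto simp: q_def)
  ultimately show "\<exists>k\<ge>L. \<exists>p i. p 0 = ?z \<and> p k = y \<and> chain_path Y d m f \<epsilon> k p i \<and>
      (\<forall>n<L. i n = \<omega> (Suc n))"
    by (intro exI[of _ "k - 1"] conjI exI[of _ q] exI[of _ "\<lambda>n. i (Suc n)"]) simp_all
qed

text \<open>The image is reached exactly. The way back follows the shifted sequence to
  \<open>x\<close> and restores \<open>\<omega>\<close> by choosing it as the appended
  sequence.\<close>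

lemma skew_recurrent_if_chain_along:
  assumes \<omega>: "\<omega> \<in> full_shift m" and x: "x \<in> Y" and xx: "chain_along Y d m f \<omega> x x"
  shows "(\<omega>, x) \<in> skew_recurrent"
proof -
  have p: "(\<omega>, x) \<in> skew_space" using \<omega> x by simp
  have q: "skew_product f (\<omega>, x) = (\<lambda>n. \<omega> (Suc n), f (\<omega> 0) x)"
    by (simp add: skew_product_def)
  have "skew_ge (\<omega>, x) (skew_product f (\<omega>, x))"
    by (rule chain_ge_image[where f = "\<lambda>_. skew_product f" and i = 1])
      (use p skew_product_closed[OF p] skew_dist_self in auto)
  moreover have "skew_ge (skew_product f (\<omega>, x)) (\<omega>, x)"
    unfolding q using shift_in_full_shift[OF \<omega>, of 1] \<omega> chain_along_shift[OF \<omega> x xx]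
    by (intro skew_ge_if_chain_along) auto
  ultimately show ?thesis
    using p by (auto simp: chain_recurrent_set_def chain_equiv_def)
qed

text \<open>
  Koenig's lemma in place of compactness of the shift space: if arbitrarily precise loops begin with a
  given prefix, then by finiteness of the alphabet so do they for some extension by one letter.
\<close>

lemma ex_chain_along_loop:
  assumes x: "x \<in> chain_recurrent_set Y d m f"
  shows "\<exists>\<omega>\<in>full_shift m. chain_along Y d m f \<omega> x x"
proof -
  \<comment> \<open>Only the letters of \<open>u\<close> below \<open>n\<close> count. The condition
    \<open>k > n\<close> excludes the trivial loop and makes letter \<open>n\<close> part of the
    loop.\<close>
  define Q where "Q = (\<lambda>n u. \<forall>\<epsilon>>0. \<exists>k>n. \<exists>p i. p 0 = x \<and> p k = x \<and>
    chain_path Y d m f \<epsilon> k p i \<and> (\<forall>j<n. i j = u j))"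
  have "Q 0 u" for u
    unfolding Q_def
  proof (intro allI impI)
    fix \<epsilon> :: real assume "\<epsilon> > 0"
    obtain k p i where "k \<ge> 1" "p 0 = x" "p k = x" "chain_path Y d m f \<epsilon> k p i"
      using chain_recurrent_loop[OF x _ \<open>\<epsilon> > 0\<close>] by auto
    then show "\<exists>k>0. \<exists>p i. p 0 = x \<and> p k = x \<and> chain_path Y d m f \<epsilon> k p i \<and> (\<forall>j<0. i j = u j)"
      by (intro exI[of _ k] exI[of _ p] exI[of _ i]) auto
  qed
  moreover have "\<exists>u'. Q (Suc n) u' \<and> (\<forall>j<n. u' j = u j)" if Qn: "Q n u" for n u
  proof -
    have "\<exists>a\<in>{1..m}. Q (Suc n) (u(n := a))"
    proof (rule ccontr)
      assume "\<not> ?thesis"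
      then have "\<forall>a\<in>{1..m}. \<exists>\<epsilon>>0. \<not> (\<exists>k>Suc n. \<exists>p i. p 0 = x \<and> p k = x \<and>
          chain_path Y d m f \<epsilon> k p i \<and> (\<forall>j<Suc n. i j = (u(n := a)) j))"
        unfolding Q_def by blast
      then obtain \<epsilon> where \<epsilon>: "\<And>a. a \<in> {1..m} \<Longrightarrow> \<epsilon> a > 0"
        "\<And>a k p i. a \<in> {1..m} \<Longrightarrow> k > Suc n \<Longrightarrow> p 0 = x \<Longrightarrow> p k = x \<Longrightarrow>
          chain_path Y d m f (\<epsilon> a) k p i \<Longrightarrow> \<not> (\<forall>j<Suc n. i j = (u(n := a)) j)"
        by metis
      \<comment> \<open>If every letter failed at its own precision, a loop at the smallest
        precision would still have some next letter, which contradicts the failure of that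
        letter.\<close>
      define e where "e = Min (insert 1 (\<epsilon> ` {1..m}))"
      have "e > 0"
        unfolding e_def using \<epsilon>(1) by (subst Min_gr_iff) auto
      then obtain k p i where p: "k > n" "p 0 = x" "p k = x" "chain_path Y d m f e k p i"
        "\<forall>j<n. i j = u j"
        using Qn unfolding Q_def by meson
      \<comment> \<open>Repetition reaches the length required at stage \<open>Suc n\<close> and
        keeps letter \<open>n\<close>.\<close>
      obtain l q j where q: "l \<ge> Suc (Suc n)" "q 0 = x" "q l = x" "chain_path Y d m f e l q j"
        "\<And>n. n < k \<Longrightarrow> j n = i n"
        by (rule chain_path_repeat[OF p(4,2,3), of "Suc (Suc n)"]) (use p(1) in auto)
      have a: "j n \<in> {1..m}"
        using q(1,4) by (auto simp: chain_path_def)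
      then have "e \<le> \<epsilon> (j n)"
        unfolding e_def by (intro Min_le) auto
      then have "chain_path Y d m f (\<epsilon> (j n)) l q j"
        using chain_path_mono[OF q(4)] by blast
      moreover have "\<forall>t<Suc n. j t = (u(n := j n)) t"
        using p(1,5) q(5) by (auto simp: less_Suc_eq)
      moreover have "Suc n < l" using q(1) by simp
      ultimately show False
        using \<epsilon>(2)[OF a _ q(2,3)] by blast
    qed
    then obtain a where "Q (Suc n) (u(n := a))" by blast
    then show ?thesis by (intro exI[of _ "u(n := a)"]) simp
  qed
  ultimately obtain u where u: "\<And>n. Q n (u n)" "\<And>n j. j < n \<Longrightarrow> u (Suc n) j = u n j"
    using dependent_nat_choice[of Q "\<lambda>n u u'. \<forall>j<n. u' j = u j"] by metis
  \<comment> \<open>Letter \<open>n\<close> is settled from stage \<open>Suc n\<close> on, so the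
    diagonal agrees with every \<open>u n\<close> below \<open>n\<close>.\<close>
  define \<omega> where "\<omega> = (\<lambda>n. u (Suc n) n)"
  have \<omega>_eq: "u n j = \<omega> j" if "j < n" for n j
    using that
  proof (induction n)
    case (Suc n)
    then show ?case using u(2)[of j n] by (cases "j = n") (auto simp: \<omega>_def)
  qed simp
  have loops: "\<exists>k>n. \<exists>p i. p 0 = x \<and> p k = x \<and> chain_path Y d m f \<epsilon> k p i \<and> (\<forall>j<n. i j = \<omega> j)"
    if "\<epsilon> > 0" for \<epsilon> n
    using u(1)[of n] that \<omega>_eq[of _ n] unfolding Q_def by simp
  have "\<omega> n \<in> {1..m}" for n
    using loops[of 1 "Suc n"] unfolding chain_path_def by (metis Suc_lessD lessI zero_less_one)
  then have "\<omega> \<in> full_shift m" by (simp add: full_shift_def)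
  moreover have "chain_along Y d m f \<omega> x x"
    unfolding chain_along_def using loops by (meson less_imp_le)
  ultimately show ?thesis by blast
qed

lemma snd_skew_recurrent: "snd ` skew_recurrent = chain_recurrent_set Y d m f"
proof (intro equalityI subsetI)
  fix x assume "x \<in> snd ` skew_recurrent"
  then obtain \<omega> where \<omega>: "(\<omega>, x) \<in> skew_recurrent" by auto
  then have in_space: "\<omega> \<in> full_shift m" "x \<in> Y"
    and "skew_ge (\<omega>, x) (skew_product f (\<omega>, x))" "skew_ge (skew_product f (\<omega>, x)) (\<omega>, x)"
    by (auto simp: chain_recurrent_set_def chain_equiv_def)
  then have "chain_equiv Y d m f x (f (\<omega> 0) x)"
    using chain_ge_snd by (fastforce simp: chain_equiv_def skew_product_def)
  then show "x \<in> chain_recurrent_set Y d m f"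
    using in_space by (auto simp: chain_recurrent_set_def full_shift_def)
next
  fix x assume x: "x \<in> chain_recurrent_set Y d m f"
  then have "x \<in> Y" by (simp add: chain_recurrent_set_def)
  then show "x \<in> snd ` skew_recurrent"
    using ex_chain_along_loop[OF x] skew_recurrent_if_chain_along by force
qed

text \<open>Recurrence of \<open>p\<close> supplies long loops along its letters. A chain to
  \<open>snd q\<close> is appended to such a loop, after which the sequence of \<open>q\<close> can
  be chosen freely.\<close>

lemma skew_ge_iff:
  assumes p: "p \<in> skew_recurrent" and q: "q \<in> skew_space"
  shows "skew_ge p q \<longleftrightarrow> chain_ge Y d m f (snd p) (snd q)"
proof
  assume ge: "chain_ge Y d m f (snd p) (snd q)"
  obtain \<omega> x \<nu> y where eq: "p = (\<omega>, x)" "q = (\<nu>, y)" by fastforce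
  have "\<omega> \<in> full_shift m" "\<nu> \<in> full_shift m"
    using p q by (auto simp: eq chain_recurrent_set_def)
  moreover have "chain_along Y d m f \<omega> x y"
    using chain_along_ge_trans[OF chain_along_if_skew_recurrent] p ge by (simp add: eq)
  ultimately show "skew_ge p q"
    unfolding eq by (rule skew_ge_if_chain_along)
qed (rule chain_ge_snd)

end


section \<open>Passage from the attractor to the whole space, and conclusion\<close>

theorem theorem12:
  fixes X :: "'a topology" and d :: "'a \<Rightarrow> 'a \<Rightarrow> real"
    and m :: nat and f :: "nat \<Rightarrow> 'a \<Rightarrow> 'a" and G :: "'a set"
  assumes "metrizable_space X" and "separable_space X" and "locally_compact_space X"
    and "Metric_space (topspace X) d" and "Metric_space.mtopology (topspace X) d = X"
    and "IFS (topspace X) d m f"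
    and "global_attractor (topspace X) d m f G"
  defines "\<pi> \<equiv> (snd :: (nat \<Rightarrow> nat) \<times> 'a \<Rightarrow> 'a)"
    and "R \<equiv> chain_recurrent_set (topspace X) d m f"
    and "nodes \<equiv> chain_nodes (topspace X) d m f"
    and "ge \<equiv> node_ge (topspace X) d m f"
    and "cgraph \<equiv> chain_graph (topspace X) d m f"
    and "R' \<equiv> chain_recurrent_set (full_shift m \<times> G) (max_dist dist_shift d) 1 (\<lambda>_. skew_product f)"
    and "nodes' \<equiv> chain_nodes (full_shift m \<times> G) (max_dist dist_shift d) 1 (\<lambda>_. skew_product f)"
    and "ge' \<equiv> node_ge (full_shift m \<times> G) (max_dist dist_shift d) 1 (\<lambda>_. skew_product f)"
    and "cgraph' \<equiv> chain_graph (full_shift m \<times> G) (max_dist dist_shift d) 1 (\<lambda>_. skew_product f)"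
  shows "\<pi> ` R' = R
    \<and> bij_betw (\<lambda>N'. \<pi> ` N') nodes' nodes
    \<and> (\<forall>N'\<in>nodes'. \<forall>M'\<in>nodes'. ge' N' M' \<longleftrightarrow> ge (\<pi> ` N') (\<pi> ` M'))
    \<and> pre_digraph.digraph_isomorphism cgraph' (induced_iso (\<lambda>N'. \<pi> ` N'))
    \<and> app_iso (induced_iso (\<lambda>N'. \<pi> ` N')) cgraph' = cgraph
    \<and> (\<forall>N\<in>nodes. R' \<inter> (full_shift m \<times> N) \<in> nodes' \<and> \<pi> ` (R' \<inter> (full_shift m \<times> N)) = N)"
proof -
  let ?M = "topspace X"
  note ifs = assms(6) and attractor = assms(7)
  have loc_compact: "locally_compact_space (Metric_space.mtopology ?M d)"
    using assms(3,5) by simp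
  note R_eq = chain_recurrent_set_attractor[OF ifs attractor loc_compact]
    and ge_eq = chain_ge_attractor_iff[OF ifs attractor loc_compact]
    and in_G = chain_recurrent_in_attractor[OF ifs attractor loc_compact]
  have GM: "G \<subseteq> ?M"
    by (rule attractor_subset[OF ifs attractor])
  have metric: "Metric_space G d"
    by (rule Metric_space.subspace[OF assms(4) GM])
  have closed: "f i x \<in> G" if "i \<in> {1..m}" "x \<in> G" for i x
    using attractor_invariant[OF ifs attractor] that by blast
  have cont: "\<exists>\<delta>>0. \<forall>y\<in>G. d x y < \<delta> \<longrightarrow> d (f i x) (f i y) < \<eta>"
    if "i \<in> {1..m}" "x \<in> G" "\<eta> > 0" for i x \<eta>
    using Metric_space.compact_uniformly_continuous_map[OF assms(4)
        attractor_compact[OF ifs attractor] bspec[OF IFS_continuous[OF ifs] that(1)] that(3)]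
      that(2) GM by blast
  have image: "\<pi> ` R' = R"
    unfolding \<pi>_def R'_def R_def R_eq[symmetric] using metric closed cont
    by (rule snd_skew_recurrent)
  have ge_iff: "chain_ge (full_shift m \<times> G) (max_dist dist_shift d) 1 (\<lambda>_. skew_product f) p q
      \<longleftrightarrow> chain_ge ?M d m f (\<pi> p) (\<pi> q)" if "p \<in> R'" "q \<in> R'" for p q
  proof -
    have q: "q \<in> full_shift m \<times> G"
      using that(2) by (simp add: R'_def chain_recurrent_set_def)
    have "chain_ge (full_shift m \<times> G) (max_dist dist_shift d) 1 (\<lambda>_. skew_product f) p q
        \<longleftrightarrow> chain_ge G d m f (\<pi> p) (\<pi> q)"
      unfolding \<pi>_def using metric closed cont that(1)[unfolded R'_def] q by (rule skew_ge_iff)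
    \<comment> \<open>Projections of recurrent points are recurrent, hence lie in \<open>G\<close>,
      where chains in \<open>G\<close> and in the whole space give the same relation.\<close>
    also have "\<dots> \<longleftrightarrow> chain_ge ?M d m f (\<pi> p) (\<pi> q)"
      using that image in_G unfolding R_def by (intro ge_eq) blast+
    finally show ?thesis .
  qed
  note transfer = chain_graph_transfer[where h = \<pi>, OF image[unfolded R_def R'_def]
      ge_iff[unfolded R'_def]]
  \<comment> \<open>First coordinates in \<open>R'\<close> already belong to
    \<open>full_shift m\<close>, so the preimages from the transfer are the sets in the
    claim.\<close>
  have "R' \<inter> (full_shift m \<times> N) = R' \<inter> \<pi> -` N" for N
    by (auto simp: R'_def chain_recurrent_set_def \<pi>_def)
  then show ?thesis
    using image transfer
    unfolding R'_def nodes_def nodes'_def ge_def ge'_def cgraph_def cgraph'_def by simp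
qed

end
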